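(* A random variable $\xi$ on $(\Omega,\mathcal F,\mathsf P)$ is $\mathcal F_\infty$-measurable if and only if there exists an $\mathcal H$-measurable random variable $\eta$ such that $\xi(\omega)=\eta(\omega)$ for all $\omega\in\{\gamma=\infty\}$.
   Context: $(\Omega,\mathcal F,\mathsf P)$ is a probability space, $\mathcal H\subset\mathcal F$ is a sub-$\sigma$-algebra, and $\gamma$ is a random variable with values in $[0,\infty]$ such that $\mathsf P(\gamma>0)=1$. For $t\in[0,\infty)$, $\mathcal F_t$ is the collection of all $A\in\mathcal F$ for which there exists $C\in\mathcal H$ with $A\cap\{t<\gamma\}=C\cap\{t<\gamma\}$; $(\mathcal F_t)_{t\ge 0}$ is a right-continuous filtration, and $\mathcal F_\infty=\sigma\big(\bigcup_{t\ge 0}\mathcal F_t\big)$. Standing assumption: this filtration contains all $\mathsf P$-null sets of $\mathcal F$ (so it satisfies the usual conditions). *)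

theory Defs
  imports "HOL-Probability.Probability"
begin

(* Real t < 0 also makes sense here: ennreal t = 0 gives the value at time 0. *)
definition gen_filt :: "'a measure \<Rightarrow> 'a measure \<Rightarrow> ('a \<Rightarrow> ennreal) \<Rightarrow> real \<Rightarrow> 'a measure" where
  "gen_filt M H \<gamma> t = sigma (space M)
     {A \<in> sets M. \<exists>C \<in> sets H.
        A \<inter> {\<omega> \<in> space M. ennreal t < \<gamma> \<omega>} = C \<inter> {\<omega> \<in> space M. ennreal t < \<gamma> \<omega>}}"

definition gen_filt_inf :: "'a measure \<Rightarrow> 'a measure \<Rightarrow> ('a \<Rightarrow> ennreal) \<Rightarrow> 'a measure" where
  "gen_filt_inf M H \<gamma> = sigma (space M) (\<Union>t\<in>{0..}. sets (gen_filt M H \<gamma> t))"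

lemma space_gen_filt [simp]: "space (gen_filt M H \<gamma> t) = space M"
  unfolding gen_filt_def by (intro space_measure_of) (auto dest: sets.sets_into_space)

lemma space_gen_filt_inf [simp]: "space (gen_filt_inf M H \<gamma>) = space M"
  unfolding gen_filt_inf_def
  using sets.sets_into_space[of _ "gen_filt M H \<gamma> _"]
  by (intro space_measure_of) fastforce

(* The generating collection is already a sigma-algebra, so taking sigma adds no sets. *)
lemma sets_gen_filt:
  assumes "subalgebra M H"
  shows "sets (gen_filt M H \<gamma> t) =
    {A \<in> sets M. \<exists>C \<in> sets H.
       A \<inter> {\<omega> \<in> space M. ennreal t < \<gamma> \<omega>} = C \<inter> {\<omega> \<in> space M. ennreal t < \<gamma> \<omega>}}"
proof -
  define T where "T = {\<omega> \<in> space M. ennreal t < \<gamma> \<omega>}"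
  let ?S = "{A \<in> sets M. \<exists>C \<in> sets H. A \<inter> T = C \<inter> T}"
  have sp: "space H = space M" using assms by (simp add: subalgebra_def)
  have "sigma_algebra (space M) ?S"
    unfolding sigma_algebra_iff2
  proof (intro conjI ballI allI impI)
    show "?S \<subseteq> Pow (space M)" using sets.sets_into_space by blast
    show "{} \<in> ?S" by auto
  next
    fix A assume A: "A \<in> ?S"
    then obtain C where C: "C \<in> sets H" "A \<inter> T = C \<inter> T" by auto
    have "(space M - A) \<inter> T = (space M - C) \<inter> T" using C(2) by blast
    moreover have "space M - C \<in> sets H" using sets.compl_sets[OF C(1)] sp by simp
    ultimately show "space M - A \<in> ?S" using A by auto
  next
    fix A :: "nat \<Rightarrow> 'a set" assume A: "range A \<subseteq> ?S"
    then have "\<forall>i. \<exists>C. C \<in> sets H \<and> A i \<inter> T = C \<inter> T" by blast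
    then obtain C where C: "\<And>i. C i \<in> sets H" "\<And>i. A i \<inter> T = C i \<inter> T" by metis
    have "(\<Union>i. A i) \<inter> T = (\<Union>i. C i) \<inter> T" using C(2) by blast
    moreover have "(\<Union>i. C i) \<in> sets H" using C(1) by blast
    ultimately show "(\<Union>i. A i) \<in> ?S" using A by blast
  qed
  then show ?thesis
    unfolding gen_filt_def T_def by (rule sigma_algebra.sets_measure_of_eq)
qed

lemma gen_filt_mono:
  assumes "subalgebra M H" "s \<le> t"
  shows "sets (gen_filt M H \<gamma> s) \<subseteq> sets (gen_filt M H \<gamma> t)"
proof -
  have sub: "{\<omega> \<in> space M. ennreal t < \<gamma> \<omega>} \<subseteq> {\<omega> \<in> space M. ennreal s < \<gamma> \<omega>}"
    using ennreal_leI[OF assms(2)] by (auto intro: order_le_less_trans)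
  show ?thesis
    unfolding sets_gen_filt[OF assms(1)] using sub by blast
qed

lemma filtration_gen_filt:
  assumes "subalgebra M H"
  shows "filtration (space M) (gen_filt M H \<gamma>)"
  by unfold_locales (simp, rule gen_filt_mono[OF assms])

lemma gen_filt_right_continuous:
  assumes "subalgebra M H"
  shows "(\<Inter>s\<in>{t<..}. sets (gen_filt M H \<gamma> s)) = sets (gen_filt M H \<gamma> t)"
proof
  show "sets (gen_filt M H \<gamma> t) \<subseteq> (\<Inter>s\<in>{t<..}. sets (gen_filt M H \<gamma> s))"
    by (intro INT_greatest gen_filt_mono[OF assms]) simp
  show "(\<Inter>s\<in>{t<..}. sets (gen_filt M H \<gamma> s)) \<subseteq> sets (gen_filt M H \<gamma> t)"
  proof
    fix A assume A: "A \<in> (\<Inter>s\<in>{t<..}. sets (gen_filt M H \<gamma> s))"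
    define s where "s n = t + 1 / real (Suc n)" for n
    have As: "A \<in> sets (gen_filt M H \<gamma> (s n))" for n
      using A by (simp add: s_def)
    have AM: "A \<in> sets M"
      using As[of 0] unfolding sets_gen_filt[OF assms] by simp
    have "\<exists>C. C \<in> sets H \<and>
        A \<inter> {\<omega> \<in> space M. ennreal (s n) < \<gamma> \<omega>} = C \<inter> {\<omega> \<in> space M. ennreal (s n) < \<gamma> \<omega>}" for n
      using As[of n] unfolding sets_gen_filt[OF assms] mem_Collect_eq Bex_def by (rule conjunct2)
    then have "\<exists>C. \<forall>n. C n \<in> sets H \<and>
        A \<inter> {\<omega> \<in> space M. ennreal (s n) < \<gamma> \<omega>} = C n \<inter> {\<omega> \<in> space M. ennreal (s n) < \<gamma> \<omega>}"
      by (intro choice allI)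
    then obtain C where C: "\<And>n. C n \<in> sets H"
      "\<And>n. A \<inter> {\<omega> \<in> space M. ennreal (s n) < \<gamma> \<omega>} =
        C n \<inter> {\<omega> \<in> space M. ennreal (s n) < \<gamma> \<omega>}"
      by auto
    define D where "D = (\<Inter>m. \<Union>n\<in>{m..}. C n)"
    have D: "D \<in> sets H" unfolding D_def using C(1) by auto
    have "\<omega> \<in> A \<longleftrightarrow> \<omega> \<in> D" if \<omega>: "\<omega> \<in> space M" "ennreal t < \<gamma> \<omega>" for \<omega>
    proof -
      have "s \<longlonglongrightarrow> t + 0"
        unfolding s_def by (intro tendsto_intros LIMSEQ_Suc[OF lim_1_over_n])
      then have "(\<lambda>n. ennreal (s n)) \<longlonglongrightarrow> ennreal t"
        by (intro tendsto_ennrealI) simp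
      from order_tendstoD(2)[OF this \<omega>(2)]
      obtain N where N: "\<And>n. n \<ge> N \<Longrightarrow> ennreal (s n) < \<gamma> \<omega>"
        by (auto simp: eventually_sequentially)
      have eq: "\<omega> \<in> A \<longleftrightarrow> \<omega> \<in> C n" if "n \<ge> N" for n
        using C(2)[of n] N[OF that] \<omega>(1) by blast
      show ?thesis
      proof
        assume "\<omega> \<in> A"
        then have "\<omega> \<in> C (max m N)" for m using eq[of "max m N"] by simp
        then have "\<omega> \<in> (\<Union>n\<in>{m..}. C n)" for m by (rule UN_I[of "max m N", rotated]) simp
        then show "\<omega> \<in> D" unfolding D_def by blast
      next
        assume "\<omega> \<in> D"
        then have "\<omega> \<in> (\<Union>n\<in>{N..}. C n)" unfolding D_def by blast
        then show "\<omega> \<in> A" using eq by auto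
      qed
    qed
    then have "A \<inter> {\<omega> \<in> space M. ennreal t < \<gamma> \<omega>} = D \<inter> {\<omega> \<in> space M. ennreal t < \<gamma> \<omega>}"
      by blast
    then show "A \<in> sets (gen_filt M H \<gamma> t)"
      unfolding sets_gen_filt[OF assms] mem_Collect_eq by (intro conjI AM bexI[OF _ D])
  qed
qed

end

theory Submission
  imports Defs
begin

text \<open>
  Write \<open>T = {\<gamma> = \<infinity>}\<close>. The heart of the matter is an explicit description of the terminal
  \<open>\<sigma>\<close>-algebra: a set \<open>A\<close> of \<open>M\<close> belongs to it exactly when \<open>A\<close> agrees on \<open>T\<close> with some set
  of \<open>H\<close> (lemma \<open>sets_gen_filt_inf\<close>). Every set known by a finite time \<open>t\<close> agrees with a set
  of \<open>H\<close> on \<open>{t < \<gamma>}\<close>, hence on the smaller set \<open>T\<close>, and sets with this property form a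
  \<open>\<sigma>\<close>-algebra. In the other direction, on \<open>{\<gamma> \<le> n}\<close> everything is revealed at time \<open>n\<close>, so
  every event inside \<open>{\<gamma> < \<infinity>}\<close> is a countable union of events known at finite times, and
  what remains on \<open>T\<close> comes from \<open>H\<close>, which is known at time \<open>0\<close>.

  The theorem is the version of this description for functions. If \<open>\<xi>\<close> agrees on \<open>T\<close> with an
  \<open>H\<close>-measurable function, so do the preimages. Conversely, the sublevel sets of \<open>\<xi>\<close>
  agree on \<open>T\<close> with sets of \<open>H\<close>, and an \<open>H\<close>-measurable function can be rebuilt from
  countably many of these sets (lemma \<open>borel_measurable_extension_of_trace\<close>), although \<open>T\<close>
  itself need not belong to \<open>H\<close>.
\<close>

text \<open>
  A real number is the infimum of the rationals above it, so \<open>f\<close> is determined on \<open>T\<close> by the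
  sets \<open>C q\<close> that agree there with \<open>{f < q}\<close>; the function \<open>inf {q. x \<in> C q}\<close> makes sense and
  is measurable on the whole space. Off \<open>T\<close> this infimum may be infinite, so it is taken in the
  extended reals.
\<close>

lemma borel_measurable_extension_of_trace:
  fixes f :: "'a \<Rightarrow> real"
  assumes trace: "\<And>a. \<exists>C\<in>sets N. {x \<in> space N. f x < a} \<inter> T = C \<inter> T"
  shows "\<exists>g\<in>borel_measurable N. \<forall>x\<in>space N \<inter> T. f x = g x"
proof -
  obtain C where C: "\<And>a. C a \<in> sets N" "\<And>a. {x \<in> space N. f x < a} \<inter> T = C a \<inter> T"
    using trace by metis
  define h :: "'a \<Rightarrow> ereal" where
    "h x = (INF q. if x \<in> C (of_rat q) then ereal (of_rat q) else \<infinity>)" for x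
  have h_measurable: "h \<in> borel_measurable N"
    unfolding h_def using C(1) by measurable
  have "h x = ereal (f x)" if x: "x \<in> space N" "x \<in> T" for x
  proof -
    have mem: "x \<in> C (of_rat q) \<longleftrightarrow> f x < of_rat q" for q
      using C(2)[of "of_rat q"] x by blast
    show ?thesis
    proof (rule antisym)
      show "ereal (f x) \<le> h x"
        unfolding h_def by (intro INF_greatest) (auto simp: mem)
      show "h x \<le> ereal (f x)"
      proof (rule dense_ge)
        fix z assume "ereal (f x) < z"
        then obtain q where "f x < of_rat q" "ereal (of_rat q) < z"
          using ereal_dense3 by (metis less_ereal.simps(1))
        then show "h x \<le> z"
          unfolding h_def by (intro INF_lower2[of q]) (auto simp: mem)
      qed
    qed
  qed
  then have "\<forall>x\<in>space N \<inter> T. f x = real_of_ereal (h x)" by simp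
  with h_measurable show ?thesis by (intro bexI[of _ "\<lambda>x. real_of_ereal (h x)"]) auto
qed

text \<open>
  The passage to the limit \<open>t \<rightarrow> \<infinity>\<close> in \<open>sets_gen_filt\<close>, with \<open>{t < \<gamma>}\<close> shrinking to
  \<open>{\<gamma> = \<infinity>}\<close>. It replaces the generated \<open>\<sigma>\<close>-algebra by a membership criterion that can be
  applied to one preimage at a time.
\<close>

lemma sets_gen_filt_inf:
  assumes H: "subalgebra M H" and \<gamma>: "\<gamma> \<in> borel_measurable M"
  shows "sets (gen_filt_inf M H \<gamma>) =
    {A \<in> sets M. \<exists>C\<in>sets H. A \<inter> {\<omega> \<in> space M. \<gamma> \<omega> = \<infinity>} = C \<inter> {\<omega> \<in> space M. \<gamma> \<omega> = \<infinity>}}"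
    (is "_ = ?S")
proof
  let ?T = "{\<omega> \<in> space M. \<gamma> \<omega> = \<infinity>}"
  \<comment> \<open>The right-hand side is the time-\<open>0\<close> \<open>\<sigma>\<close>-algebra of the random time \<open>indicator ?T\<close>,
    which is positive precisely on \<open>?T\<close>; this shows that it is a \<open>\<sigma>\<close>-algebra.\<close>
  have S: "?S = sets (gen_filt M H (indicator ?T) 0)"
  proof -
    have "{\<omega> \<in> space M. ennreal 0 < indicator ?T \<omega>} = ?T"
      by (auto simp: indicator_def)
    then show ?thesis unfolding sets_gen_filt[OF H] by simp
  qed
  have "sets (gen_filt M H \<gamma> t) \<subseteq> ?S" for t
  proof -
    have "?T \<subseteq> {\<omega> \<in> space M. ennreal t < \<gamma> \<omega>}" by auto
    then show ?thesis unfolding sets_gen_filt[OF H] by blast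
  qed
  then have "(\<Union>t\<in>{0..}. sets (gen_filt M H \<gamma> t)) \<subseteq> sets (gen_filt M H (indicator ?T) 0)"
    unfolding S by (rule UN_least)
  from sets.sigma_sets_subset[OF this]
  have "sigma_sets (space M) (\<Union>t\<in>{0..}. sets (gen_filt M H \<gamma> t)) \<subseteq> ?S"
    unfolding S space_gen_filt .
  moreover have "(\<Union>t\<in>{0..}. sets (gen_filt M H \<gamma> t)) \<subseteq> Pow (space M)"
    using sets.sets_into_space[of _ "gen_filt M H \<gamma> _"] by fastforce
  ultimately show "sets (gen_filt_inf M H \<gamma>) \<subseteq> ?S"
    unfolding gen_filt_inf_def by simp
next
  let ?T = "{\<omega> \<in> space M. \<gamma> \<omega> = \<infinity>}"
  let ?G = "gen_filt_inf M H \<gamma>"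
  have gen: "A \<in> sets ?G" if "A \<in> sets (gen_filt M H \<gamma> t)" "0 \<le> t" for A t
    unfolding gen_filt_inf_def
    using that sets.sets_into_space[of _ "gen_filt M H \<gamma> _"]
    by (subst sets_measure_of) (fastforce intro: sigma_sets.Basic)+
  have H_known: "C \<in> sets ?G" if "C \<in> sets H" for C
    using that H by (intro gen[of C 0]) (auto simp: sets_gen_filt[OF H] subalgebra_def)
  have finite_known: "A \<inter> {\<omega> \<in> space M. \<gamma> \<omega> < \<infinity>} \<in> sets ?G" if A: "A \<in> sets M" for A
  proof -
    \<comment> \<open>This set is disjoint from \<open>{n < \<gamma>}\<close>, so it agrees there with the empty set.\<close>
    have "A \<inter> {\<omega> \<in> space M. \<gamma> \<omega> \<le> of_nat n} \<in> sets (gen_filt M H \<gamma> (real n))" for n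
      unfolding sets_gen_filt[OF H] using A \<gamma>
      by (auto simp: ennreal_of_nat_eq_real_of_nat intro!: bexI[of _ "{}"])
    then have "(\<Union>n. A \<inter> {\<omega> \<in> space M. \<gamma> \<omega> \<le> of_nat n}) \<in> sets ?G"
      by (intro sets.countable_UN image_subsetI gen) auto
    also have "(\<Union>n. A \<inter> {\<omega> \<in> space M. \<gamma> \<omega> \<le> of_nat n}) = A \<inter> {\<omega> \<in> space M. \<gamma> \<omega> < \<infinity>}"
    proof -
      have "(\<exists>n. x \<le> of_nat n) \<longleftrightarrow> x < \<infinity>" for x :: ennreal
        by (auto dest: ennreal_Ex_less_of_nat intro: less_imp_le order_le_less_trans of_nat_less_top)
      then show ?thesis by auto
    qed
    finally show ?thesis .
  qed
  show "?S \<subseteq> sets ?G"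
  proof
    fix A assume "A \<in> ?S"
    then obtain C where A: "A \<in> sets M" and C: "C \<in> sets H" "A \<inter> ?T = C \<inter> ?T" by auto
    let ?F = "{\<omega> \<in> space M. \<gamma> \<omega> < \<infinity>}"
    have "A = (A \<inter> ?F) \<union> (C - ?F)"
    proof -
      have "A \<subseteq> space M" "C \<subseteq> space M"
        using A C(1) H sets.sets_into_space by (fastforce simp: subalgebra_def)+
      moreover have "space M - ?F = ?T" by (auto simp flip: top.not_eq_extremum)
      ultimately show ?thesis using C(2) by blast
    qed
    moreover have "?F \<in> sets ?G"
      using finite_known[OF sets.top] by (simp add: Int_absorb1 subset_iff)
    then have "(A \<inter> ?F) \<union> (C - ?F) \<in> sets ?G"
      by (intro sets.Un[OF finite_known[OF A] sets.Diff[OF H_known[OF C(1)]]])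
    ultimately show "A \<in> sets ?G" by simp
  qed
qed

theorem lemma2p1:
  fixes M H :: "'a measure" and \<gamma> :: "'a \<Rightarrow> ennreal" and \<xi> :: "'a \<Rightarrow> real"
  assumes "prob_space M"
    and "subalgebra M H"
    and "\<gamma> \<in> borel_measurable M"
    and "measure M {\<omega> \<in> space M. 0 < \<gamma> \<omega>} = 1"
    and "\<And>t. 0 \<le> t \<Longrightarrow> null_sets M \<subseteq> sets (gen_filt M H \<gamma> t)"
    and "\<xi> \<in> borel_measurable M"
  shows "\<xi> \<in> borel_measurable (gen_filt_inf M H \<gamma>) \<longleftrightarrow>
    (\<exists>\<eta> :: 'a \<Rightarrow> real. \<eta> \<in> borel_measurable H \<and>
       (\<forall>\<omega> \<in> space M. \<gamma> \<omega> = \<infinity> \<longrightarrow> \<xi> \<omega> = \<eta> \<omega>))"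
proof
  let ?T = "{\<omega> \<in> space M. \<gamma> \<omega> = \<infinity>}"
  have space_H: "space H = space M" using assms(2) by (simp add: subalgebra_def)
  note sets_inf = sets_gen_filt_inf[OF assms(2,3)]
  {
    assume \<xi>: "\<xi> \<in> borel_measurable (gen_filt_inf M H \<gamma>)"
    have "\<exists>C\<in>sets H. {\<omega> \<in> space H. \<xi> \<omega> < a} \<inter> ?T = C \<inter> ?T" for a
    proof -
      have "{\<omega> \<in> space (gen_filt_inf M H \<gamma>). \<xi> \<omega> < a} \<in> sets (gen_filt_inf M H \<gamma>)"
        using \<xi> by measurable
      then show ?thesis unfolding sets_inf space_H by simp
    qed
    from borel_measurable_extension_of_trace[OF this]
    show "\<exists>\<eta> :: 'a \<Rightarrow> real. \<eta> \<in> borel_measurable H \<and>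
       (\<forall>\<omega> \<in> space M. \<gamma> \<omega> = \<infinity> \<longrightarrow> \<xi> \<omega> = \<eta> \<omega>)"
      by (auto simp: space_H)
  next
    assume "\<exists>\<eta> :: 'a \<Rightarrow> real. \<eta> \<in> borel_measurable H \<and>
       (\<forall>\<omega> \<in> space M. \<gamma> \<omega> = \<infinity> \<longrightarrow> \<xi> \<omega> = \<eta> \<omega>)"
    then obtain \<eta> :: "'a \<Rightarrow> real" where \<eta>: "\<eta> \<in> borel_measurable H"
      and eq: "\<And>\<omega>. \<omega> \<in> space M \<Longrightarrow> \<gamma> \<omega> = \<infinity> \<Longrightarrow> \<xi> \<omega> = \<eta> \<omega>" by blast
    show "\<xi> \<in> borel_measurable (gen_filt_inf M H \<gamma>)"
    proof (rule measurableI)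
      fix B :: "real set" assume B: "B \<in> sets borel"
      have "(\<xi> -` B \<inter> space M) \<inter> ?T = (\<eta> -` B \<inter> space M) \<inter> ?T" using eq by auto
      moreover have "\<xi> -` B \<inter> space M \<in> sets M" using assms(6) B by (rule measurable_sets)
      moreover have "\<eta> -` B \<inter> space M \<in> sets H"
        using measurable_sets[OF \<eta> B] by (simp add: space_H)
      ultimately show "\<xi> -` B \<inter> space (gen_filt_inf M H \<gamma>) \<in> sets (gen_filt_inf M H \<gamma>)"
        unfolding sets_inf by auto
    qed simp
  }
qed

end
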